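(* Let $V:\mathbb{R}\to\mathbb{C}$ lie in $L^1(\mathbb{R})\cap L^2(\mathbb{R})$ and let $H=-\frac{d^2}{dx^2}+V$ act in $L^2(\mathbb{R})$ with domain $W^{2,2}(\mathbb{R})$. Then every eigenvalue $\lambda$ of $H$ which does not lie on the positive real axis satisfies $$|\lambda|\le\frac{\|V\|_1^2}{4}.$$
   Context: $\|V\|_1=\int_{\mathbb{R}}|V(x)|\,dx$. *)

theory Defs
  imports "HOL-Analysis.Analysis"
begin

text \<open>Elements of the function spaces are represented by functions; two of them stand for the
  same element iff they agree almost everywhere.\<close>

definition Lp :: "real \<Rightarrow> (real \<Rightarrow> complex) set" where
  "Lp p = {f \<in> borel_measurable lebesgue. integrable lebesgue (\<lambda>x. cmod (f x) powr p)}"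

definition L1_norm :: "(real \<Rightarrow> complex) \<Rightarrow> real" where
  "L1_norm f = (LINT x|lebesgue. cmod (f x))"

definition locally_integrable :: "(real \<Rightarrow> complex) \<Rightarrow> bool" where
  "locally_integrable f \<longleftrightarrow> (\<forall>a b. set_integrable lebesgue {a..b} f)"

text \<open>Real-valued test functions give the same weak derivatives as complex-valued ones, since the
  defining identity is linear in the test function.\<close>

definition test_functions :: "(real \<Rightarrow> real) set" where
  "test_functions = {\<phi>. (\<forall>n x. (deriv ^^ n) \<phi> differentiable (at x)) \<and>
     compact (closure {x. \<phi> x \<noteq> 0})}"

definition has_weak_deriv :: "nat \<Rightarrow> (real \<Rightarrow> complex) \<Rightarrow> (real \<Rightarrow> complex) \<Rightarrow> bool" where
  "has_weak_deriv k f g \<longleftrightarrow> locally_integrable f \<and> locally_integrable g \<and>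
     (\<forall>\<phi>\<in>test_functions.
        (LINT x|lebesgue. (deriv ^^ k) \<phi> x *\<^sub>R f x) =
        (-1) ^ k * (LINT x|lebesgue. \<phi> x *\<^sub>R g x))"

text \<open>The weak derivative is determined only up to a null set, so this is a choice of
  representative.\<close>

definition weak_deriv :: "nat \<Rightarrow> (real \<Rightarrow> complex) \<Rightarrow> (real \<Rightarrow> complex)" where
  "weak_deriv k f = (SOME g. has_weak_deriv k f g)"

definition sobolev :: "nat \<Rightarrow> real \<Rightarrow> (real \<Rightarrow> complex) set" where
  "sobolev k p = {f \<in> Lp p. \<forall>j\<in>{1..k}. \<exists>g\<in>Lp p. has_weak_deriv j f g}"

definition schroedinger :: "(real \<Rightarrow> complex) \<Rightarrow> (real \<Rightarrow> complex) \<Rightarrow> (real \<Rightarrow> complex)" where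
  "schroedinger V f = (\<lambda>x. - weak_deriv 2 f x + V x * f x)"

text \<open>Eigenvalues of an operator \<open>A\<close> with domain \<open>D\<close>; equality and non-vanishing are those of
  equivalence classes.\<close>

definition is_eigenvalue ::
  "(real \<Rightarrow> complex) set \<Rightarrow> ((real \<Rightarrow> complex) \<Rightarrow> (real \<Rightarrow> complex)) \<Rightarrow> complex \<Rightarrow> bool" where
  "is_eigenvalue D A z \<longleftrightarrow>
     (\<exists>f\<in>D. \<not> (AE x in lebesgue. f x = 0) \<and> (AE x in lebesgue. A f x = z * f x))"

end

theory Submission
  imports Defs
begin

text \<open>Choose \<open>\<mu>\<close> with \<open>\<mu>\<^sup>2 = - z\<close> and \<open>Re \<mu> > 0\<close>, which is possible because \<open>z\<close> is off the positive axis and may be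
  assumed nonzero. The resolvent of \<open>-d\<^sup>2/dx\<^sup>2\<close> at \<open>z\<close> has the kernel \<open>exp (- \<mu> |x - y|) / (2 \<mu>)\<close>, which is bounded by
  \<open>1 / (2 |\<mu>|)\<close>. An eigenfunction \<open>f\<close> equals minus the resolvent applied to \<open>V f\<close>, and \<open>V f\<close> is integrable
  as a product of two square integrable functions; so \<open>|f| \<le> \<parallel>V f\<parallel>\<^sub>1 / (2 |\<mu>|)\<close> almost everywhere.
  Multiplying by \<open>|V|\<close> and integrating yields \<open>2 |\<mu>| \<le> \<parallel>V\<parallel>\<^sub>1\<close>. The bound on \<open>f\<close> is obtained by duality: the
  resolvent is applied to a test function \<open>\<psi>\<close> rather than to \<open>V f\<close>, which gives
  \<open>|\<integral> \<psi> f| \<le> \<parallel>V f\<parallel>\<^sub>1 / (2 |\<mu>|) \<parallel>\<psi>\<parallel>\<^sub>1\<close>.\<close>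

subsection \<open>Smooth functions on the line\<close>

text \<open>The derivative enters as a witness and not through \<open>deriv\<close>, which requires
  domain and codomain to be the same field; here the values may be complex. The last derivative need
  not be continuous at a fixed order, a difference that disappears once all orders are
  required.\<close>

primrec Ck :: "nat \<Rightarrow> (real \<Rightarrow> 'a::real_normed_vector) \<Rightarrow> bool" where
  "Ck 0 f \<longleftrightarrow> True"
| "Ck (Suc n) f \<longleftrightarrow> (\<exists>f'. (\<forall>x. (f has_vector_derivative f' x) (at x)) \<and> Ck n f')"

definition smooth :: "(real \<Rightarrow> 'a::real_normed_vector) \<Rightarrow> bool" where
  "smooth f \<longleftrightarrow> (\<forall>n. Ck n f)"

lemma Ck_SucI: "(\<And>x. (f has_vector_derivative f' x) (at x)) \<Longrightarrow> Ck n f' \<Longrightarrow> Ck (Suc n) f"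
  unfolding Ck.simps by blast

lemma Ck_SucD: "Ck (Suc n) f \<Longrightarrow> Ck n f"
  by (induction n arbitrary: f) auto

text \<open>Each order brings its own witness for the derivative; uniqueness of derivatives
  identifies them all with a single \<open>f'\<close>.\<close>

lemma smooth_derivE:
  assumes "smooth f"
  obtains f' where "\<And>x. (f has_vector_derivative f' x) (at x)" "smooth f'"
proof -
  from assms have "Ck (Suc 0) f" unfolding smooth_def by blast
  then obtain f' where f': "\<And>x. (f has_vector_derivative f' x) (at x)" by auto
  have "Ck n f'" for n
  proof -
    have "Ck (Suc n) f" using assms unfolding smooth_def by blast
    then obtain g where g: "\<And>x. (f has_vector_derivative g x) (at x)" "Ck n g" by auto
    have "f' = g" using vector_derivative_unique_at[OF f' g(1)] by auto
    with g show ?thesis by simp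
  qed
  with f' that show ?thesis unfolding smooth_def by blast
qed

lemma smooth_continuous: "smooth f \<Longrightarrow> continuous_on S f"
  by (metis smooth_derivE has_vector_derivative_continuous continuous_at_imp_continuous_on)

lemma smooth_measurable: "smooth f \<Longrightarrow> f \<in> borel_measurable lebesgue"
  by (rule measurable_completion) (simp add: borel_measurable_continuous_onI smooth_continuous)

lemma Ck_const: "Ck n (\<lambda>x. c)"
proof (induction n arbitrary: c)
  case (Suc n)
  have "((\<lambda>x. c) has_vector_derivative 0) (at x)" for x :: real by (rule has_vector_derivative_const)
  with Suc show ?case by (metis Ck.simps(2))
qed simp

lemma Ck_add: "Ck n f \<Longrightarrow> Ck n g \<Longrightarrow> Ck n (\<lambda>x. f x + g x)"
proof (induction n arbitrary: f g)
  case (Suc n)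
  then obtain f' g' where "\<forall>x. (f has_vector_derivative f' x) (at x)" "Ck n f'"
      "\<forall>x. (g has_vector_derivative g' x) (at x)" "Ck n g'" by auto
  with Suc.IH[of f' g'] show ?case
    by (auto intro!: exI[of _ "\<lambda>x. f' x + g' x"] has_vector_derivative_add)
qed simp

lemma (in bounded_linear) Ck: "Ck n g \<Longrightarrow> Ck n (\<lambda>x. f (g x))"
proof (induction n arbitrary: g)
  case (Suc n)
  then obtain g' where "\<forall>x. (g has_vector_derivative g' x) (at x)" "Ck n g'" by auto
  with Suc.IH[of g'] show ?case
    by (auto intro!: exI[of _ "\<lambda>x. f (g' x)"] has_vector_derivative)
qed simp

lemma (in bounded_bilinear) Ck: "Ck n f \<Longrightarrow> Ck n g \<Longrightarrow> Ck n (\<lambda>x. prod (f x) (g x))"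
proof (induction n arbitrary: f g)
  case (Suc n)
  then obtain f' g' where d: "\<forall>x. (f has_vector_derivative f' x) (at x)" "Ck n f'"
      "\<forall>x. (g has_vector_derivative g' x) (at x)" "Ck n g'" by auto
  \<comment> \<open>The Leibniz derivative still contains \<open>f\<close> and \<open>g\<close>
    themselves, so \<open>Ck_SucD\<close> lowers their order to fit the induction
    hypothesis.\<close>
  have "Ck n (\<lambda>x. prod (f x) (g' x) + prod (f' x) (g x))"
    using Suc.IH Suc.prems[THEN Ck_SucD] d by (intro Ck_add) auto
  with d show ?case
    by (auto intro!: exI[of _ "\<lambda>x. prod (f x) (g' x) + prod (f' x) (g x)"] has_vector_derivative)
qed simp

lemma Ck_affine: "Ck n f \<Longrightarrow> Ck n (\<lambda>x. f (c * x + d))"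
proof (induction n arbitrary: f)
  case (Suc n)
  then obtain f' where d: "\<forall>x. (f has_vector_derivative f' x) (at x)" "Ck n f'" by auto
  have "((\<lambda>x. f (c * x + d)) has_vector_derivative c *\<^sub>R f' (c * x + d)) (at x)" for x
    by (rule vector_diff_chain_at[unfolded o_def])
       (use d in \<open>auto intro!: derivative_eq_intros\<close>)
  moreover have "Ck n (\<lambda>x. c *\<^sub>R f' (c * x + d))"
    using Suc.IH[OF d(2)] by (rule bounded_linear.Ck[OF bounded_linear_scaleR_right])
  ultimately show ?case by (rule Ck_SucI)
qed simp

lemma smooth_const: "smooth (\<lambda>x. a)"
  and smooth_add: "smooth f \<Longrightarrow> smooth g \<Longrightarrow> smooth (\<lambda>x. f x + g x)"
  and smooth_bounded_linear: "bounded_linear L \<Longrightarrow> smooth f \<Longrightarrow> smooth (\<lambda>x. L (f x))"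
  and smooth_affine: "smooth f \<Longrightarrow> smooth (\<lambda>x. f (c * x + d))"
  by (auto simp: smooth_def Ck_const Ck_add bounded_linear.Ck Ck_affine)

lemma smooth_scaleR: "smooth a \<Longrightarrow> smooth f \<Longrightarrow> smooth (\<lambda>x. a x *\<^sub>R f x)"
  by (auto simp: smooth_def intro: bounded_bilinear.Ck[OF bounded_bilinear_scaleR])

lemma smooth_mult:
  fixes f g :: "real \<Rightarrow> 'a::real_normed_algebra"
  shows "smooth f \<Longrightarrow> smooth g \<Longrightarrow> smooth (\<lambda>x. f x * g x)"
  by (auto simp: smooth_def intro: bounded_bilinear.Ck[OF bounded_bilinear_mult])

lemma smooth_diff: "smooth f \<Longrightarrow> smooth g \<Longrightarrow> smooth (\<lambda>x. f x - g x)"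
  using smooth_add[OF _ smooth_bounded_linear[OF bounded_linear_minus[OF bounded_linear_ident]], of f g]
  by simp

lemma smooth_prod:
  fixes f :: "'i \<Rightarrow> real \<Rightarrow> 'a::real_normed_field"
  assumes "\<And>i. i \<in> I \<Longrightarrow> smooth (f i)"
  shows "smooth (\<lambda>x. \<Prod>i\<in>I. f i x)"
  using assms by (induction I rule: infinite_finite_induct) (simp_all add: smooth_mult smooth_const)

text \<open>Bridge from derivatives as witnesses to the iterated \<open>deriv\<close> by which
  \<open>test_functions\<close> is defined.\<close>

lemma smooth_funpow_deriv:
  assumes "smooth \<phi>"
  shows "smooth ((deriv ^^ n) \<phi>)"
proof (induction n)
  case (Suc n)
  obtain h where h: "\<And>x. ((deriv ^^ n) \<phi> has_vector_derivative h x) (at x)" "smooth h"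
    using smooth_derivE[OF Suc] by blast
  have "deriv ((deriv ^^ n) \<phi>) = h"
    using h(1) by (auto simp: has_real_derivative_iff_has_vector_derivative[symmetric] DERIV_imp_deriv)
  with h show ?case by simp
qed (use assms in simp)

lemma test_functionsI:
  fixes \<phi> :: "real \<Rightarrow> real"
  assumes "smooth \<phi>" and supp: "\<And>x. R < \<bar>x\<bar> \<Longrightarrow> \<phi> x = 0"
  shows "\<phi> \<in> test_functions"
proof -
  have "(deriv ^^ n) \<phi> differentiable (at x)" for n x
    using smooth_derivE[OF smooth_funpow_deriv[OF assms(1)]]
    by (metis differentiableI_vector)
  moreover have "{x. \<phi> x \<noteq> 0} \<subseteq> cball 0 R"
    using supp by (fastforce simp: not_less)
  then have "bounded {x. \<phi> x \<noteq> 0}" by (meson bounded_cball bounded_subset)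
  ultimately show ?thesis by (simp add: test_functions_def)
qed

text \<open>The family is closed under differentiation up to linear combinations, so smoothness of all
  its members follows by one induction.\<close>

definition flat :: "nat \<Rightarrow> real \<Rightarrow> real" where
  "flat k x = (if 0 < x then inverse x ^ k * exp (- inverse x) else 0)"

text \<open>From the right, substituting \<open>inverse x\<close> reduces the claim to the decay of
  \<open>x ^ k / exp x\<close> at infinity; from the left the function is zero.\<close>

lemma flat_tendsto_0: "(flat k \<longlongrightarrow> 0) (at 0)"
proof -
  have "((\<lambda>x::real. x ^ k / exp x) \<longlongrightarrow> 0) at_top" by (rule tendsto_power_div_exp_0)
  then have "((\<lambda>x::real. inverse x ^ k / exp (inverse x)) \<longlongrightarrow> 0) (at_right 0)"
    by (rule filterlim_compose[OF _ filterlim_inverse_at_top_right])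
  then have "(flat k \<longlongrightarrow> 0) (at_right 0)"
    by (rule Lim_transform_eventually)
       (auto simp: flat_def eventually_at_filter exp_minus field_simps)
  moreover have "(flat k \<longlongrightarrow> 0) (at_left 0)"
    by (rule Lim_transform_eventually[OF tendsto_const])
       (auto simp: flat_def eventually_at_filter)
  ultimately show ?thesis by (simp add: filterlim_split_at)
qed

lemma flat_deriv:
  "(flat k has_vector_derivative (flat (k + 2) x - real k * flat (k + 1) x)) (at x)"
proof (cases x "0::real" rule: linorder_cases)
  case less
  have "(flat k has_real_derivative 0) (at x)"
    by (rule has_field_derivative_transform_within[OF DERIV_const, of "-x"])
       (use less in \<open>auto simp: flat_def dist_real_def\<close>)
  with less show ?thesis
    by (simp add: has_real_derivative_iff_has_vector_derivative[symmetric] flat_def)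
next
  case equal
  \<comment> \<open>Dividing by \<open>h\<close> adds one factor \<open>inverse h\<close>, so the
    difference quotient at the origin is again a member of the family, namely
    \<open>flat (Suc k)\<close>.\<close>
  have "((\<lambda>h. (flat k h - flat k 0) / h) \<longlongrightarrow> 0) (at 0)"
    by (rule Lim_transform_eventually[OF flat_tendsto_0[of "Suc k"]])
       (auto simp: flat_def eventually_at_filter field_simps)
  then have "(flat k has_real_derivative 0) (at 0)"
    by (simp add: has_field_derivative_iff)
  with equal show ?thesis
    by (simp add: has_real_derivative_iff_has_vector_derivative[symmetric] flat_def)
next
  case greater
  have "((\<lambda>x. inverse x ^ k * exp (- inverse x)) has_real_derivative
      (flat (k + 2) x - real k * flat (k + 1) x)) (at x)"
    using greater
    by (auto intro!: derivative_eq_intros simp: flat_def field_simps power2_eq_square)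
      (cases k; simp)
  then have "(flat k has_real_derivative (flat (k + 2) x - real k * flat (k + 1) x)) (at x)"
    by (rule has_field_derivative_transform_within[where d = x])
       (use greater in \<open>auto simp: flat_def dist_real_def\<close>)
  then show ?thesis by (simp add: has_real_derivative_iff_has_vector_derivative)
qed

lemma smooth_flat: "smooth (flat k)"
proof -
  have "Ck n (flat k)" for n
  proof (induction n arbitrary: k)
    case (Suc n)
    have "Ck n (\<lambda>x. flat (k + 2) x + (- real k) * flat (k + 1) x)"
      by (intro Ck_add Suc bounded_linear.Ck[OF bounded_linear_mult_right])
    then show ?case using flat_deriv[of k] by (intro Ck_SucI[of "flat k"]) auto
  qed simp
  then show ?thesis by (simp add: smooth_def)
qed

lemma flat_0_bounds: "0 \<le> flat 0 x" "flat 0 x \<le> 1"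
  by (auto simp: flat_def)

text \<open>Dilates of \<open>flat 0\<close> thus approach the indicator of the positive half-line;
  products of two of them will approach indicators of open intervals.\<close>

lemma flat_0_tendsto_1:
  assumes "0 < x"
  shows "(\<lambda>n. flat 0 (real n * x)) \<longlonglongrightarrow> 1"
proof -
  have "filterlim (\<lambda>n. real n * x) at_top sequentially"
    by (rule filterlim_at_top_mult_tendsto_pos[OF tendsto_const assms filterlim_real_sequentially])
  then have "(\<lambda>n. exp (- inverse (real n * x))) \<longlonglongrightarrow> exp (- 0)"
    by (intro tendsto_intros tendsto_inverse_0_at_top)
  moreover have "\<forall>\<^sub>F n in sequentially. exp (- inverse (real n * x)) = flat 0 (real n * x)"
    using eventually_gt_at_top[of 0] by eventually_elim (use assms in \<open>simp add: flat_def\<close>)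
  ultimately show ?thesis using Lim_transform_eventually by fastforce
qed

lemma smooth_cutoff_exists:
  obtains \<kappa> :: "real \<Rightarrow> real" where "smooth \<kappa>" "\<kappa> 0 = 1" "\<And>x. 1 < \<bar>x\<bar> \<Longrightarrow> \<kappa> x = 0"
proof
  \<comment> \<open>The two factors cut off at -1 and at 1. Each equals \<open>exp (-1)\<close> at
    the origin, which the prefactor \<open>exp 2\<close> compensates.\<close>
  let ?\<kappa> = "\<lambda>x. exp 2 * (flat 0 (1 * x + 1) * flat 0 ((-1) * x + 1))"
  show "smooth ?\<kappa>"
    by (intro smooth_mult smooth_const smooth_affine smooth_flat)
  show "?\<kappa> 0 = 1" by (simp add: flat_def mult_exp_exp)
  show "\<And>x. 1 < \<bar>x\<bar> \<Longrightarrow> ?\<kappa> x = 0" by (auto simp: flat_def abs_if split: if_splits)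
qed

subsection \<open>Essential bounds by duality\<close>

text \<open>An open set of reals is a countable union of open intervals; the n-th approximant uses
  the first n of them, each smoothed with steepness n.\<close>

lemma open_indicator_smooth_approx:
  fixes U :: "real set"
  assumes "open U"
  obtains \<psi> :: "nat \<Rightarrow> real \<Rightarrow> real" where
    "\<And>n. smooth (\<psi> n)" "\<And>n x. 0 \<le> \<psi> n x" "\<And>n x. \<psi> n x \<le> indicator U x"
    "\<And>x. (\<lambda>n. \<psi> n x) \<longlonglongrightarrow> indicator U x"
proof -
  obtain \<D> where \<D>: "countable \<D>" "\<D> \<subseteq> Pow U" "\<And>X. X \<in> \<D> \<Longrightarrow> \<exists>a b. X = box a b" "\<Union>\<D> = U"
    using open_countable_Union_open_box[OF assms] by metis
  \<comment> \<open>Adding the empty set makes the family nonempty, so that it can be enumerated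
    even if \<open>U\<close> is empty.\<close>
  define D where "D = from_nat_into (insert {} \<D>)"
  have range_D: "range D = insert {} \<D>"
    unfolding D_def using \<D>(1) by (intro range_from_nat_into) auto
  have "\<exists>a b. D i = {a<..<b}" for i
  proof -
    have "D i \<in> insert {} \<D>" using range_D by blast
    then consider "D i = {0<..<0}" | "\<exists>a b. D i = box a b" using \<D>(3)[of "D i"] by auto
    then show ?thesis by cases (metis, metis box_real(1))
  qed
  then have "\<forall>i. \<exists>a b. D i = {a<..<b}" by blast
  then obtain a b where ab: "\<And>i. D i = {a i<..<b i}"
    unfolding choice_iff by blast
  have D_sub: "D i \<subseteq> U" for i using range_D \<D>(2) by blast
  have D_cover: "\<exists>i. x \<in> D i" if "x \<in> U" for x
    using that \<D>(4) range_D by (metis UnionE imageE insertI2)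
  \<comment> \<open>\<open>\<theta> n i\<close> tends to the indicator of \<open>D i\<close>; the complementary product turns finitely many
    of them into a single smooth function below the indicator of the union.\<close>
  define \<theta> where "\<theta> n i x = flat 0 (real n * x + (- real n * a i)) * flat 0 ((- real n) * x + real n * b i)" for n i x
  define \<psi> where "\<psi> n x = 1 - (\<Prod>i<n. 1 - \<theta> n i x)" for n x
  have \<theta>01: "0 \<le> \<theta> n i x" "\<theta> n i x \<le> 1" for n i x
    using flat_0_bounds by (auto simp: \<theta>_def intro: mult_le_one)
  have \<psi>01: "0 \<le> \<psi> n x" "\<psi> n x \<le> 1" for n x
    using \<theta>01 by (auto simp: \<psi>_def intro!: prod_le_1 prod_nonneg)
  have \<theta>_outside: "\<theta> n i x = 0" if "x \<notin> D i" for n i x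
  proof -
    have "real n * (x - a i) \<le> 0 \<or> real n * (b i - x) \<le> 0"
      using that ab[of i] by (auto simp: mult_le_0_iff)
    then show ?thesis by (auto simp: \<theta>_def flat_def algebra_simps)
  qed
  have \<psi>_outside: "\<psi> n x = 0" if "x \<notin> U" for n x
  proof -
    have "\<theta> n i x = 0" for i using \<theta>_outside D_sub that by blast
    then show ?thesis by (simp add: \<psi>_def)
  qed
  show thesis
  proof
    show "smooth (\<psi> n)" for n
      unfolding \<psi>_def \<theta>_def
      by (intro smooth_diff smooth_prod smooth_mult smooth_const smooth_affine smooth_flat)
    show "0 \<le> \<psi> n x" for n x by (rule \<psi>01)
    show "\<psi> n x \<le> indicator U x" for n x
      using \<psi>01 \<psi>_outside by (auto simp: indicator_def)
    show "(\<lambda>n. \<psi> n x) \<longlonglongrightarrow> indicator U x" for x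
    proof (cases "x \<in> U")
      case True
      then obtain i where i: "x \<in> D i" using D_cover by blast
      \<comment> \<open>One factor of the product is \<open>1 - \<theta> n i x\<close> and the
        others are at most 1. Hence \<open>\<psi> n\<close> dominates every bump already included
        and is pushed up to 1.\<close>
      have lower: "\<theta> n i x \<le> \<psi> n x" if "i < n" for n
      proof -
        have "(\<Prod>j<n. 1 - \<theta> n j x) = (1 - \<theta> n i x) * (\<Prod>j\<in>{..<n}-{i}. 1 - \<theta> n j x)"
          using that by (subst prod.remove[of _ i]) auto
        also have "\<dots> \<le> (1 - \<theta> n i x) * 1"
          using \<theta>01 by (intro mult_left_mono prod_le_1) auto
        finally show ?thesis by (simp add: \<psi>_def)
      qed
      have "(\<lambda>n. flat 0 (real n * (x - a i)) * flat 0 (real n * (b i - x))) \<longlonglongrightarrow> 1 * 1"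
        using i ab[of i] by (intro tendsto_mult flat_0_tendsto_1) auto
      then have lim: "(\<lambda>n. \<theta> n i x) \<longlonglongrightarrow> 1"
        by (simp add: \<theta>_def algebra_simps)
      have "(\<lambda>n. \<psi> n x) \<longlonglongrightarrow> 1"
        by (rule tendsto_sandwich[OF _ _ lim tendsto_const])
           (use lower \<psi>01 in \<open>auto intro: eventually_mono[OF eventually_gt_at_top[of i]]\<close>)
      with True show ?thesis by simp
    qed (simp add: \<psi>_outside)
  qed
qed

text \<open>Makes the averaging theorem available for \<open>lebesgue\<close>, the completion of
  \<open>lborel\<close>.\<close>

lemma sigma_finite_measure_completion:
  assumes "sigma_finite_measure M"
  shows "sigma_finite_measure (completion M)"
proof -
  obtain A where "countable A" "A \<subseteq> sets M" "\<Union>A = space M" "\<forall>a\<in>A. emeasure M a \<noteq> \<infinity>"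
    using sigma_finite_measure.sigma_finite_countable[OF assms] by metis
  then show ?thesis
    by (intro sigma_finite_measure.intro exI[of _ A])
       (auto simp: emeasure_completion subset_iff main_part_sets)
qed

text \<open>The duality between L1 and L-infinity, with only smooth functions on the L1 side. The
  integral bound passes by dominated convergence from test functions to indicators of open sets,
  then by outer regularity to indicators of measurable sets. All averages then lie in
  \<open>cball 0 M\<close>, and the averaging theorem puts almost every value there.\<close>

lemma ess_bound_if_test_bound:
  fixes f :: "real \<Rightarrow> complex"
  assumes li: "locally_integrable f" and M: "0 \<le> M"
    and bound: "\<And>\<psi> R. smooth \<psi> \<Longrightarrow> (\<And>x. R < \<bar>x\<bar> \<Longrightarrow> \<psi> x = 0) \<Longrightarrow>
      norm (LINT x|lebesgue. \<psi> x *\<^sub>R f x) \<le> M * (LINT x|lebesgue. \<bar>\<psi> x\<bar>)"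
  shows "AE x in lebesgue. norm (f x) \<le> M"
proof -
  have "AE x in lebesgue. indicator {-real m..real m} x *\<^sub>R f x \<in> cball 0 M" for m :: nat
  proof -
    \<comment> \<open>The averaging theorem needs an integrable function, while \<open>f\<close> is
      only locally integrable. Countably many truncations recover \<open>f\<close>.\<close>
    define F where "F x = indicator {-real m..real m} x *\<^sub>R f x" for x
    let ?I = "{-real m<..<real m}"
    have int_F: "integrable lebesgue F"
      using li unfolding locally_integrable_def set_integrable_def F_def by blast
    have F_eq: "c x *\<^sub>R f x = c x *\<^sub>R F x" if "\<And>x. x \<notin> ?I \<Longrightarrow> c x = 0" for c :: "real \<Rightarrow> real" and x
      using that[of x] by (cases "x \<in> ?I") (auto simp: F_def indicator_def)
    have meas_I: "S \<subseteq> ?I \<Longrightarrow> S \<in> sets lebesgue \<Longrightarrow> S \<in> lmeasurable" for S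
      by (rule fmeasurableI2[of ?I]) auto

    have open_bound: "norm (LINT x|lebesgue. indicator U x *\<^sub>R F x) \<le> M * measure lebesgue U"
      if U: "open U" "U \<subseteq> ?I" for U
    proof -
      obtain \<psi> :: "nat \<Rightarrow> real \<Rightarrow> real" where \<psi>: "\<And>n. smooth (\<psi> n)" "\<And>n x. 0 \<le> \<psi> n x"
          "\<And>n x. \<psi> n x \<le> indicator U x" "\<And>x. (\<lambda>n. \<psi> n x) \<longlonglongrightarrow> indicator U x"
        using open_indicator_smooth_approx[OF U(1)] by blast
      have \<psi>0: "\<psi> n x = 0" if "x \<notin> U" for n x
        using \<psi>(2)[of n x] \<psi>(3)[of n x] that by simp
      have \<psi>1: "\<psi> n x \<le> 1" for n x
        using \<psi>(3)[of n x] indicator_le_1[of U x] by (rule order_trans)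
      have U_meas: "U \<in> lmeasurable" using U by (intro meas_I) auto
      have [measurable]: "\<psi> n \<in> borel_measurable lebesgue" for n
        using smooth_measurable[OF \<psi>(1)] .
      have [measurable]: "U \<in> sets lebesgue" using U by auto
      have [measurable]: "F \<in> borel_measurable lebesgue" using int_F by auto
      have b: "norm (LINT x|lebesgue. \<psi> n x *\<^sub>R F x) \<le> M * measure lebesgue U" for n
      proof -
        have "norm (LINT x|lebesgue. \<psi> n x *\<^sub>R f x) \<le> M * (LINT x|lebesgue. \<bar>\<psi> n x\<bar>)"
          by (rule bound[OF \<psi>(1), of m]) (use \<psi>0 U(2) in force)
        moreover have "(LINT x|lebesgue. \<psi> n x *\<^sub>R f x) = (LINT x|lebesgue. \<psi> n x *\<^sub>R F x)"
          by (intro Bochner_Integration.integral_cong refl F_eq) (use \<psi>0 U(2) in blast)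
        moreover have "(LINT x|lebesgue. \<bar>\<psi> n x\<bar>) \<le> (LINT x|lebesgue. indicator U x)"
          using \<psi>(2,3) U_meas by (intro integral_mono') (auto simp: integrable_indicator_iff fmeasurable_def)
        ultimately show ?thesis using M U_meas
          by (simp add: order_trans[OF _ mult_left_mono])
      qed
      have "(\<lambda>n. LINT x|lebesgue. \<psi> n x *\<^sub>R F x) \<longlonglongrightarrow> (LINT x|lebesgue. indicator U x *\<^sub>R F x)"
      proof (rule integral_dominated_convergence)
        show "integrable lebesgue (\<lambda>x. norm (F x))" using int_F by simp
        show "AE x in lebesgue. (\<lambda>n. \<psi> n x *\<^sub>R F x) \<longlonglongrightarrow> indicator U x *\<^sub>R F x"
          by (intro AE_I2 tendsto_scaleR \<psi>(4) tendsto_const)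
        show "AE x in lebesgue. norm (\<psi> n x *\<^sub>R F x) \<le> norm (F x)" for n
          using \<psi>(2) \<psi>1 by (auto intro!: AE_I2 mult_left_le_one_le)
      qed measurable
      then show ?thesis
        by (rule LIMSEQ_le_const2[OF tendsto_norm]) (use b in auto)
    qed

    show ?thesis
      unfolding F_def[symmetric]
    proof (rule sigma_finite_measure.averaging_theorem[OF _ int_F])
      show "sigma_finite_measure (lebesgue :: real measure)"
        by (rule sigma_finite_measure_completion[OF sigma_finite_lborel])
      fix A :: "real set" assume A: "A \<in> sets lebesgue" "0 < measure lebesgue A"
      \<comment> \<open>\<open>measure\<close> takes the value 0 on sets of infinite measure, so its
        positivity already yields finiteness.\<close>
      have A_lm: "A \<in> lmeasurable"
      proof (rule fmeasurableI[OF A(1)])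
        show "emeasure lebesgue A < \<infinity>"
          using A(2) by (auto simp: measure_def less_top[symmetric])
      qed
      \<comment> \<open>Inside the open interval \<open>?I\<close>, open neighbourhoods of the set
        can be kept within the range of \<open>open_bound\<close>. The integral of \<open>F\<close>
        is unaffected: \<open>F\<close> vanishes outside the closed interval and the two endpoints
        form a null set.\<close>
      define B where "B = A \<inter> ?I"
      have B[measurable]: "B \<in> sets lebesgue" using A by (auto simp: B_def)
      have "\<exists>U. open U \<and> B \<subseteq> U \<and> U - B \<in> lmeasurable \<and> measure lebesgue (U - B) < 1 / real (Suc k)" for k
      proof -
        obtain U where "open U" "B \<subseteq> U" "U - B \<in> lmeasurable"
            "emeasure lebesgue (U - B) < ennreal (1 / real (Suc k))"
          using sets_lebesgue_outer_open[OF B, of "1 / real (Suc k)"] by auto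
        then show ?thesis
          by (auto intro!: exI[of _ U] simp: emeasure_eq_measure2 ennreal_less_iff)
      qed
      then obtain U where U: "\<And>k. open (U k)" "\<And>k. B \<subseteq> U k" "\<And>k. U k - B \<in> lmeasurable"
          "\<And>k. measure lebesgue (U k - B) < 1 / real (Suc k)" by metis
      \<comment> \<open>Finite intersections make the neighbourhoods decreasing, so that their
        indicators converge pointwise, up to a null set to the indicator of
        \<open>B\<close>.\<close>
      define W where "W k = (\<Inter>j\<le>k. U j) \<inter> ?I" for k
      have W: "open (W k)" "B \<subseteq> W k" "W k \<subseteq> ?I" "W k \<subseteq> U k" for k
        using U(1) U(2) by (auto simp: W_def B_def intro!: open_Int open_INT)
      have [measurable]: "W k \<in> sets lebesgue" for k using W(1) by auto
      have [measurable]: "F \<in> borel_measurable lebesgue" using int_F by auto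
      have "decseq W" unfolding W_def decseq_def by auto
      have B_lm: "B \<in> lmeasurable" by (rule meas_I) (auto simp: B_def[symmetric] B, auto simp: B_def)
      have W_diff: "measure lebesgue (W k - B) \<le> 1 / real (Suc k)" for k
        using measure_mono_fmeasurable[of "W k - B" "U k - B" lebesgue] U(3,4)[of k] W(4)[of k]
        by fastforce
      have W_meas: "measure lebesgue (W k) \<le> measure lebesgue B + 1 / real (Suc k)" for k
      proof -
        have "measure lebesgue (W k) = measure lebesgue (B \<union> (W k - B))"
          using W(2)[of k] by (simp add: Un_absorb1)
        also have "\<dots> \<le> measure lebesgue B + measure lebesgue (W k - B)"
          by (intro measure_Un_le) auto
        finally show ?thesis using W_diff[of k] by linarith
      qed
      have "measure lebesgue ((\<Inter>k. W k) - B) \<le> 1 / real (Suc k)" for k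
      proof (rule order_trans[OF measure_mono_fmeasurable W_diff[of k]])
        show "W k - B \<in> lmeasurable" using W(3)[of k] by (intro meas_I) auto
      qed auto
      moreover have "(\<lambda>k. 1 / real (Suc k)) \<longlonglongrightarrow> 0" by (rule LIMSEQ_Suc[OF lim_1_over_n])
      ultimately have "measure lebesgue ((\<Inter>k. W k) - B) \<le> 0"
        by (meson LIMSEQ_le_const)
      moreover have "(\<Inter>k. W k) - B \<in> lmeasurable"
        using W(3)[of 0] by (intro meas_I) auto
      ultimately have null: "(\<Inter>k. W k) - B \<in> null_sets lebesgue"
        by (auto simp: null_sets_def fmeasurableD emeasure_eq_measure2 measure_le_0_iff)
      have "(\<lambda>k. LINT x|lebesgue. indicator (W k) x *\<^sub>R F x) \<longlonglongrightarrow> (LINT x|lebesgue. indicator B x *\<^sub>R F x)"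
      proof (rule integral_dominated_convergence)
        show "integrable lebesgue (\<lambda>x. norm (F x))" using int_F by simp
        show "AE x in lebesgue. (\<lambda>k. indicator (W k) x *\<^sub>R F x) \<longlonglongrightarrow> indicator B x *\<^sub>R F x"
        proof (rule AE_mp[OF AE_not_in[OF null]], intro AE_I2 impI)
          fix x assume "x \<notin> (\<Inter>k. W k) - B"
          then have eq: "indicator (\<Inter>k. W k) x = (indicator B x :: real)"
            using W(2) by (auto simp: indicator_def)
          have "(\<lambda>k. indicator (W k) x :: real) \<longlonglongrightarrow> indicator B x"
            unfolding eq[symmetric] by (rule LIMSEQ_indicator_decseq[OF \<open>decseq W\<close>])
          then show "(\<lambda>k. indicator (W k) x *\<^sub>R F x) \<longlonglongrightarrow> indicator B x *\<^sub>R F x"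
            by (intro tendsto_intros)
        qed
      qed (auto simp: indicator_def)
      then have "norm (LINT x|lebesgue. indicator B x *\<^sub>R F x) \<le> M * (measure lebesgue B + 0)"
      proof (rule LIMSEQ_le[OF tendsto_norm])
        show "(\<lambda>k. M * (measure lebesgue B + 1 / real (Suc k))) \<longlonglongrightarrow> M * (measure lebesgue B + 0)"
          by (intro tendsto_intros \<open>(\<lambda>k. 1 / real (Suc k)) \<longlonglongrightarrow> 0\<close>)
        have "norm (LINT x|lebesgue. indicator (W k) x *\<^sub>R F x) \<le> M * (measure lebesgue B + 1 / real (Suc k))" for k
          using open_bound[OF W(1) W(3), of k] mult_left_mono[OF W_meas[of k] M] by linarith
        then show "\<exists>N. \<forall>n\<ge>N. norm (LINT x|lebesgue. indicator (W n) x *\<^sub>R F x)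
            \<le> M * (measure lebesgue B + 1 / real (Suc n))" by blast
      qed
      also have "M * (measure lebesgue B + 0) \<le> M * measure lebesgue A"
        using M B A_lm by (auto simp: B_def intro!: mult_left_mono measure_mono_fmeasurable)
      also have "(LINT x|lebesgue. indicator B x *\<^sub>R F x) = (LINT x|lebesgue. indicator A x *\<^sub>R F x)"
      proof (rule integral_cong_AE)
        have "{-real m, real m} \<in> null_sets lebesgue" by (simp add: negligible_iff_null_sets[symmetric])
        then show "AE x in lebesgue. indicator B x *\<^sub>R F x = indicator A x *\<^sub>R F x"
          by (rule AE_mp[OF AE_not_in]) (auto simp: B_def F_def indicator_def)
      qed (use A(1) in measurable)
      finally show "(1 / measure lebesgue A) *\<^sub>R set_lebesgue_integral lebesgue A F \<in> cball 0 M"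
        using A(2) by (simp add: set_lebesgue_integral_def field_simps)
    qed simp
  qed
  then have "AE x in lebesgue. \<forall>m::nat. indicator {-real m..real m} x *\<^sub>R f x \<in> cball 0 M"
    by (simp add: AE_all_countable)
  then show ?thesis
  proof (rule AE_mp, intro AE_I2 impI)
    fix x assume *: "\<forall>m::nat. indicator {-real m..real m} x *\<^sub>R f x \<in> cball 0 M"
    obtain m :: nat where "\<bar>x\<bar> \<le> real m" using real_arch_simple by blast
    with *[rule_format, of m] show "norm (f x) \<le> M" by (simp add: indicator_def abs_le_iff)
  qed
qed

subsection \<open>The free resolvent on test functions\<close>

text \<open>The function \<open>E\<close> is the convolution of \<open>\<psi>\<close> with \<open>exp (- \<mu> x)\<close> on the positive half-line; the
  resolvent kernel is composed of this function and its mirror image.\<close>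

lemma half_line_solution:
  fixes \<mu> :: complex and \<psi> :: "real \<Rightarrow> real"
  assumes \<mu>: "0 < Re \<mu>" and \<psi>: "smooth \<psi>" and supp: "\<And>x. R \<le> \<bar>x\<bar> \<Longrightarrow> \<psi> x = 0" and R: "0 \<le> R"
  obtains E K where "smooth E"
    "\<And>x. (E has_vector_derivative (complex_of_real (\<psi> x) - \<mu> * E x)) (at x)"
    "\<And>x S. R \<le> S \<Longrightarrow> \<bar>x\<bar> \<le> S \<Longrightarrow> norm (E x) \<le> integral {-S..x} (\<lambda>y. \<bar>\<psi> y\<bar>)"
    "\<And>x. norm (E x) \<le> K * exp (- Re \<mu> * \<bar>x\<bar>)"
proof -
  define m where "m = Re \<mu>"
  have norm_exp: "norm (exp (\<mu> * complex_of_real x)) = exp (m * x)"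
    "norm (exp (- (\<mu> * complex_of_real x))) = exp (- m * x)" for x
    by (simp_all add: norm_exp_eq_Re m_def)
  have cont: "continuous_on S \<psi>" for S by (rule smooth_continuous[OF \<psi>])
  have abs_int: "(\<lambda>y. \<bar>\<psi> y\<bar>) integrable_on {a..b}" for a b
    by (intro integrable_continuous_real continuous_intros cont)
  have int_0: "integral {a..b} (\<lambda>y. \<bar>\<psi> y\<bar>) = 0" if "b \<le> -R \<or> R \<le> a" for a b
  proof -
    have "integral {a..b} (\<lambda>y. \<bar>\<psi> y\<bar>) = integral {a..b} (\<lambda>y. 0)"
      by (rule integral_cong) (use that supp in \<open>auto simp: abs_if\<close>)
    then show ?thesis by simp
  qed
  \<comment> \<open>Integrating factor: with \<open>A\<close> an antiderivative of
    \<open>exp (\<mu> x) \<psi> x\<close>, the product \<open>exp (- \<mu> x) (A x - A (-R))\<close>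
    solves \<open>E' = \<psi> - \<mu> E\<close> and vanishes to the left of the support.\<close>
  have "\<And>x. isCont (\<lambda>x. exp (\<mu> * complex_of_real x) * complex_of_real (\<psi> x)) x"
    using cont[of UNIV] by (auto intro!: continuous_intros simp: continuous_on_eq_continuous_at)
  then obtain A where A: "\<And>x. (A has_vector_derivative (exp (\<mu> * complex_of_real x) * complex_of_real (\<psi> x))) (at x)"
    using einterval_antiderivative[of "-\<infinity>" "\<infinity>" "\<lambda>x. exp (\<mu> * complex_of_real x) * complex_of_real (\<psi> x)"]
    by auto
  \<comment> \<open>Since \<open>m\<close> is positive, the weight on \<open>{a..b}\<close> is
    largest at \<open>b\<close>; multiplication by \<open>exp (- m * b)\<close> later removes the
    exponential altogether.\<close>
  have key: "norm (A b - A a) \<le> exp (m * b) * integral {a..b} (\<lambda>y. \<bar>\<psi> y\<bar>)" if "a \<le> b" for a b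
  proof -
    have A_int: "((\<lambda>x. exp (\<mu> * complex_of_real x) * complex_of_real (\<psi> x)) has_integral (A b - A a)) {a..b}"
      by (rule fundamental_theorem_of_calculus[OF that has_vector_derivative_at_within[OF A]])
    have "norm (integral {a..b} (\<lambda>x. exp (\<mu> * complex_of_real x) * complex_of_real (\<psi> x)))
        \<le> integral {a..b} (\<lambda>y. exp (m * b) * \<bar>\<psi> y\<bar>)"
    proof (rule integral_norm_bound_integral)
      show "(\<lambda>x. exp (\<mu> * complex_of_real x) * complex_of_real (\<psi> x)) integrable_on {a..b}"
        using A_int by (rule has_integral_integrable)
      show "(\<lambda>y. exp (m * b) * \<bar>\<psi> y\<bar>) integrable_on {a..b}"
        by (intro integrable_continuous_real continuous_intros cont)
      show "norm (exp (\<mu> * complex_of_real x) * complex_of_real (\<psi> x)) \<le> exp (m * b) * \<bar>\<psi> x\<bar>"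
        if "x \<in> {a..b}" for x
        using that \<mu> by (auto simp: norm_mult norm_exp m_def intro!: mult_right_mono)
    qed
    then show ?thesis using A_int by (simp add: integral_unique)
  qed
  define E where "E x = exp (- (\<mu> * complex_of_real x)) * (A x - A (-R))" for x
  \<comment> \<open>\<open>A\<close> is constant to the left of the support, so the base point
    \<open>-R\<close> may be moved to any \<open>-S\<close>.\<close>
  have A_left: "A (-S) = A (-R)" if "R \<le> S" for S
    using key[of "-S" "-R"] that by (simp add: int_0)
  have E_bound: "norm (E x) \<le> integral {-S..x} (\<lambda>y. \<bar>\<psi> y\<bar>)" if "R \<le> S" "\<bar>x\<bar> \<le> S" for x S
  proof -
    have "norm (E x) = exp (- m * x) * norm (A x - A (-S))"
      using A_left[OF that(1)] by (simp add: E_def norm_mult m_def)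
    also have "\<dots> \<le> exp (- m * x) * (exp (m * x) * integral {-S..x} (\<lambda>y. \<bar>\<psi> y\<bar>))"
      using that by (intro mult_left_mono key) auto
    also have "\<dots> = integral {-S..x} (\<lambda>y. \<bar>\<psi> y\<bar>)"
      by (simp add: mult.assoc[symmetric] mult_exp_exp)
    finally show ?thesis .
  qed
  define L where "L = integral {-R..R} (\<lambda>y. \<bar>\<psi> y\<bar>)"
  have L: "0 \<le> L" unfolding L_def by (intro Henstock_Kurzweil_Integration.integral_nonneg abs_int) auto
  \<comment> \<open>Left of the support \<open>E\<close> is zero. Within \<open>{-R..R}\<close> it
    is at most \<open>L\<close>, and \<open>exp (m * R)\<close> absorbs the decay factor. To the
    right \<open>A\<close> is constant and only \<open>exp (- m * x)\<close> varies.\<close>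
  have E_decay: "norm (E x) \<le> (L * exp (m * R)) * exp (- m * \<bar>x\<bar>)" for x
  proof -
    consider "x \<le> -R" | "-R < x" "x \<le> R" | "R < x" by linarith
    then show ?thesis
    proof cases
      case 1
      then have "norm (E x) \<le> 0" using E_bound[of "-x" x] R by (simp add: int_0)
      then show ?thesis using L by (simp add: order_trans[OF _ mult_nonneg_nonneg])
    next
      case 2
      then have "norm (E x) \<le> integral {-R..x} (\<lambda>y. \<bar>\<psi> y\<bar>)" by (intro E_bound) auto
      also have "\<dots> \<le> L" unfolding L_def using 2 by (intro integral_subset_le abs_int) auto
      also have "\<dots> \<le> L * exp (m * R - m * \<bar>x\<bar>)"
        using L 2 \<mu> by (simp add: m_def mult_le_cancel_left1 abs_le_iff)
      finally show ?thesis by (simp add: mult_exp_exp mult.assoc)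
    next
      case 3
      then have "A x = A R" using key[of R x] by (simp add: int_0)
      then have "norm (E x) = exp (- m * x) * norm (A R - A (-R))"
        by (simp add: E_def norm_mult m_def)
      also have "\<dots> \<le> exp (- m * x) * (exp (m * R) * L)"
        unfolding L_def using R by (intro mult_left_mono key) auto
      finally show ?thesis using 3 R by (simp add: mult_ac)
    qed
  qed
  have E_deriv: "(E has_vector_derivative (complex_of_real (\<psi> x) + (-\<mu>) * E x)) (at x)" for x
  proof -
    have "((\<lambda>z. exp (- (\<mu> * z))) has_field_derivative (- \<mu> * exp (- (\<mu> * complex_of_real x)))) (at (complex_of_real x))"
      by (auto intro!: derivative_eq_intros)
    then have "((\<lambda>x. exp (- (\<mu> * complex_of_real x))) has_vector_derivative
        (- \<mu> * exp (- (\<mu> * complex_of_real x)))) (at x)"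
      by (rule has_vector_derivative_real_field)
    then have "(E has_vector_derivative exp (- (\<mu> * complex_of_real x)) * (exp (\<mu> * complex_of_real x) * complex_of_real (\<psi> x))
        + (- \<mu> * exp (- (\<mu> * complex_of_real x))) * (A x - A (-R))) (at x)"
      unfolding E_def by (intro has_vector_derivative_mult) (auto intro!: derivative_eq_intros A)
    moreover have "exp (- (\<mu> * complex_of_real x)) * (exp (\<mu> * complex_of_real x) * complex_of_real (\<psi> x))
        = complex_of_real (\<psi> x)"
      by (simp add: mult.assoc[symmetric] mult_exp_exp)
    ultimately show ?thesis by (simp add: E_def mult.assoc)
  qed
  \<comment> \<open>Bootstrapping: the differential equation expresses the derivative of
    \<open>E\<close> by \<open>\<psi>\<close> and \<open>E\<close>, so each order of regularity
    gives the next.\<close>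
  have "Ck n E" for n
  proof (induction n)
    case (Suc n)
    then have "Ck n (\<lambda>x. complex_of_real (\<psi> x) + (-\<mu>) * E x)"
      using \<psi> by (intro Ck_add bounded_linear.Ck[OF bounded_linear_of_real]
          bounded_linear.Ck[OF bounded_linear_mult_right]) (auto simp: smooth_def)
    with E_deriv show ?case by (rule Ck_SucI)
  qed simp
  then have "smooth E" by (simp add: smooth_def)
  from that[OF this _ E_bound E_decay[unfolded m_def]] E_deriv show thesis by simp
qed

text \<open>\<open>\<phi>\<close> is minus the resolvent of \<open>-d^2/dx^2\<close> at
  \<open>-\<mu>^2\<close> applied to \<open>\<psi>\<close>, assembled from a half-line solution and
  the mirror image of another. In the sup bound these use the mass of \<open>\<psi>\<close> to the
  left and to the right of \<open>x\<close>, which together make the full L1 norm.\<close>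

lemma resolvent_of_test_function:
  fixes \<mu> :: complex and \<psi> :: "real \<Rightarrow> real"
  assumes \<mu>: "0 < Re \<mu>" and \<psi>: "smooth \<psi>" and supp: "\<And>x. R < \<bar>x\<bar> \<Longrightarrow> \<psi> x = 0"
  obtains \<phi> \<phi>' K where "smooth \<phi>" "smooth \<phi>'"
    "\<And>x. (\<phi> has_vector_derivative \<phi>' x) (at x)"
    "\<And>x. (\<phi>' has_vector_derivative (complex_of_real (\<psi> x) + \<mu>\<^sup>2 * \<phi> x)) (at x)"
    "\<And>x. norm (\<phi> x) \<le> (LINT x|lebesgue. \<bar>\<psi> x\<bar>) / (2 * norm \<mu>)"
    "\<And>x. norm (\<phi> x) \<le> K * exp (- Re \<mu> * \<bar>x\<bar>)"
    "\<And>x. norm (\<phi>' x) \<le> K * exp (- Re \<mu> * \<bar>x\<bar>)"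
proof -
  \<comment> \<open>\<open>half_line_solution\<close> wants a nonnegative radius and vanishing
    already at distance equal to it, whereas \<open>R\<close> may be negative and its condition is
    strict.\<close>
  define r where "r = \<bar>R\<bar> + 1"
  have r: "0 \<le> r" and supp': "\<And>x. r \<le> \<bar>x\<bar> \<Longrightarrow> \<psi> x = 0"
    unfolding r_def using supp by auto
  have \<psi>r: "smooth (\<lambda>x. \<psi> (- x))" using smooth_affine[OF \<psi>, of "-1" 0] by simp
  have supp'_r: "\<psi> (- x) = 0" if "r \<le> \<bar>x\<bar>" for x using supp'[of "- x"] that by simp
  have \<mu>0: "\<mu> \<noteq> 0" using \<mu> by auto
  obtain E1 K1 where E1: "smooth E1"
    "\<And>x. (E1 has_vector_derivative (complex_of_real (\<psi> x) - \<mu> * E1 x)) (at x)"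
    "\<And>x S. r \<le> S \<Longrightarrow> \<bar>x\<bar> \<le> S \<Longrightarrow> norm (E1 x) \<le> integral {-S..x} (\<lambda>y. \<bar>\<psi> y\<bar>)"
    "\<And>x. norm (E1 x) \<le> K1 * exp (- Re \<mu> * \<bar>x\<bar>)"
    using half_line_solution[OF \<mu> \<psi> supp' r] by blast
  obtain F K2 where F: "smooth F"
    "\<And>x. (F has_vector_derivative (complex_of_real (\<psi> (- x)) - \<mu> * F x)) (at x)"
    "\<And>x S. r \<le> S \<Longrightarrow> \<bar>x\<bar> \<le> S \<Longrightarrow> norm (F x) \<le> integral {-S..x} (\<lambda>y. \<bar>\<psi> (- y)\<bar>)"
    "\<And>x. norm (F x) \<le> K2 * exp (- Re \<mu> * \<bar>x\<bar>)"
    using half_line_solution[OF \<mu> \<psi>r supp'_r r] by blast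
  define E2 where "E2 x = F (- x)" for x
  have E2: "smooth E2" using smooth_affine[OF F(1), of "-1" 0] by (simp add: E2_def[abs_def])
  have E2': "(E2 has_vector_derivative (\<mu> * E2 x - complex_of_real (\<psi> x))) (at x)" for x
  proof -
    have "(uminus has_vector_derivative (-1 :: real)) (at x)"
      by (auto intro!: derivative_eq_intros)
    from vector_diff_chain_at[OF this F(2)] show ?thesis
      by (simp add: o_def E2_def[abs_def])
  qed
  \<comment> \<open>The terms with \<open>\<psi>\<close> have opposite signs in the derivatives of
    \<open>E1\<close> and \<open>E2\<close>: they cancel in the derivative of the sum and add up in
    that of the difference.\<close>
  define \<phi> where "\<phi> x = (- 1 / (2 * \<mu>)) * (E1 x + E2 x)" for x
  define \<phi>' where "\<phi>' x = (1 / 2) * (E1 x - E2 x)" for x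
  \<comment> \<open>Dominates both coefficients, so that one constant serves the decay of
    \<open>\<phi>\<close> and of \<open>\<phi>'\<close>.\<close>
  define C where "C = norm (1 / (2 * \<mu>)) + 1 / 2"
  let ?e = "\<lambda>x. exp (- Re \<mu> * \<bar>x\<bar>)"
  have K: "0 \<le> K1" "0 \<le> K2"
    using order_trans[OF norm_ge_zero E1(4)[of 0]] order_trans[OF norm_ge_zero F(4)[of 0]] by auto
  have E12: "norm (E1 x) + norm (E2 x) \<le> (K1 + K2) * ?e x" for x
    using E1(4)[of x] F(4)[of "-x"] by (simp add: E2_def distrib_right)
  have le: "a \<le> C * (K1 + K2) * ?e x"
    if "a \<le> c * (norm (E1 x) + norm (E2 x))" "0 \<le> c" "c \<le> C" for a c x
  proof -
    have "a \<le> c * ((K1 + K2) * ?e x)"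
      using that(1) mult_left_mono[OF E12 that(2)] by (rule order_trans)
    also have "\<dots> \<le> C * ((K1 + K2) * ?e x)"
      using that(3) K by (intro mult_right_mono) auto
    finally show ?thesis by (simp add: mult.assoc)
  qed
  show thesis
  proof
    show "smooth \<phi>" unfolding \<phi>_def
      by (intro smooth_bounded_linear[OF bounded_linear_mult_right] smooth_add E1 E2)
    show "smooth \<phi>'" unfolding \<phi>'_def
      by (intro smooth_bounded_linear[OF bounded_linear_mult_right] smooth_diff E1 E2)
    show "(\<phi> has_vector_derivative \<phi>' x) (at x)" for x
    proof -
      have "(\<phi> has_vector_derivative (- 1 / (2 * \<mu>)) * ((\<psi> x - \<mu> * E1 x) + (\<mu> * E2 x - \<psi> x))) (at x)"
        unfolding \<phi>_def by (intro has_vector_derivative_mult_right has_vector_derivative_add E1 E2')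
      moreover have "(- 1 / (2 * \<mu>)) * ((\<psi> x - \<mu> * E1 x) + (\<mu> * E2 x - \<psi> x)) = \<phi>' x"
        using \<mu>0 by (simp add: \<phi>'_def field_simps)
      ultimately show ?thesis by metis
    qed
    show "(\<phi>' has_vector_derivative (complex_of_real (\<psi> x) + \<mu>\<^sup>2 * \<phi> x)) (at x)" for x
    proof -
      have "(\<phi>' has_vector_derivative (1 / 2) * ((\<psi> x - \<mu> * E1 x) - (\<mu> * E2 x - \<psi> x))) (at x)"
        unfolding \<phi>'_def by (intro has_vector_derivative_mult_right has_vector_derivative_diff E1 E2')
      moreover have "(1 / 2) * ((\<psi> x - \<mu> * E1 x) - (\<mu> * E2 x - \<psi> x)) = complex_of_real (\<psi> x) + \<mu>\<^sup>2 * \<phi> x"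
        using \<mu>0 by (simp add: \<phi>_def field_simps power2_eq_square)
      ultimately show ?thesis by metis
    qed
    show "norm (\<phi> x) \<le> (LINT x|lebesgue. \<bar>\<psi> x\<bar>) / (2 * norm \<mu>)" for x
    proof -
      \<comment> \<open>The interval \<open>{-S..S}\<close> has to contain both the support of
        \<open>\<psi>\<close> and the point \<open>x\<close> at which it is split.\<close>
      define S where "S = max r \<bar>x\<bar>"
      have S: "r \<le> S" "\<bar>x\<bar> \<le> S" by (auto simp: S_def)
      have "norm (E2 x) \<le> integral {-S..-x} (\<lambda>y. \<bar>\<psi> (- y)\<bar>)"
        using F(3)[of S "-x"] S by (simp add: E2_def)
      also have "\<dots> = integral {x..S} (\<lambda>y. \<bar>\<psi> y\<bar>)"
        using Henstock_Kurzweil_Integration.integral_reflect_real[of S x "\<lambda>y. \<bar>\<psi> y\<bar>"] by simp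
      finally have "norm (E1 x) + norm (E2 x) \<le> integral {-S..x} (\<lambda>y. \<bar>\<psi> y\<bar>) + integral {x..S} (\<lambda>y. \<bar>\<psi> y\<bar>)"
        using E1(3)[OF S] by linarith
      also have "\<dots> = integral {-S..S} (\<lambda>y. \<bar>\<psi> y\<bar>)"
        using S by (intro Henstock_Kurzweil_Integration.integral_combine integrable_continuous_real
            continuous_intros smooth_continuous[OF \<psi>]) auto
      also have "\<dots> = (LINT x:{-S..S}|lebesgue. \<bar>\<psi> x\<bar>)"
        by (rule set_lebesgue_integral_eq_integral(2)[symmetric])
           (intro absolutely_integrable_continuous_real continuous_intros smooth_continuous[OF \<psi>])
      also have "\<dots> = (LINT x|lebesgue. \<bar>\<psi> x\<bar>)"
        unfolding set_lebesgue_integral_def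
        by (intro Bochner_Integration.integral_cong refl)
           (use S supp' in \<open>force simp: indicator_def abs_le_iff not_le\<close>)
      finally have "norm (E1 x + E2 x) \<le> (LINT x|lebesgue. \<bar>\<psi> x\<bar>)"
        using norm_triangle_ineq[of "E1 x" "E2 x"] by linarith
      then show ?thesis by (simp add: \<phi>_def norm_mult norm_divide divide_right_mono)
    qed
    show "norm (\<phi> x) \<le> C * (K1 + K2) * ?e x" for x
      by (rule le[of _ "norm (1 / (2 * \<mu>))"])
         (auto simp: \<phi>_def C_def norm_mult norm_divide divide_right_mono norm_triangle_ineq)
    show "norm (\<phi>' x) \<le> C * (K1 + K2) * ?e x" for x
      by (rule le[of _ "1 / 2"])
         (auto simp: \<phi>'_def C_def norm_mult norm_divide divide_right_mono norm_triangle_ineq4)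
  qed
qed

lemma integrable_exp_minus_abs:
  fixes c :: real
  assumes "0 < c"
  shows "integrable lebesgue (\<lambda>x. exp (- c * \<bar>x\<bar>))"
proof -
  define h :: "real \<Rightarrow> real" where "h x = indicator {0..} x * exp (- c * x)" for x
  have "(\<lambda>x. exp (- c * x)) absolutely_integrable_on {0..}"
    by (rule nonnegative_absolutely_integrable_1)
       (use integrable_on_exp_minus_to_infinity[OF assms, of 0] in auto)
  then have h: "integrable lebesgue h"
    by (simp add: set_integrable_def h_def[abs_def])
  \<comment> \<open>At the origin both summands contribute, so the sum serves as a dominating
    function and not as an equal one.\<close>
  then have "integrable lebesgue (\<lambda>x. h x + h (- x))"
    using lebesgue_integrable_real_affine[OF h, of "-1" 0] by simp
  then show ?thesis
  proof (rule Bochner_Integration.integrable_bound)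
    show "(\<lambda>x. exp (- c * \<bar>x\<bar>)) \<in> borel_measurable lebesgue"
      by (rule measurable_completion) simp
  qed (auto simp: h_def indicator_def)
qed

subsection \<open>Weak solutions\<close>

lemma has_vector_derivative_zero_outside:
  fixes u :: "real \<Rightarrow> 'a::real_normed_vector"
  assumes "(u has_vector_derivative d) (at x)" "\<And>y. R < \<bar>y\<bar> \<Longrightarrow> u y = 0" "R < \<bar>x\<bar>"
  shows "d = 0"
proof -
  have "open {y::real. R < \<bar>y\<bar>}" by (intro open_Collect_less continuous_intros)
  then have "((\<lambda>_. 0) has_vector_derivative d) (at x)"
    using assms by (intro has_vector_derivative_transform_within_open[OF assms(1)]) auto
  then show ?thesis
    using vector_derivative_unique_at[OF _ has_vector_derivative_const] by blast
qed

lemma bounded_if_compact_support: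
  fixes c :: "real \<Rightarrow> 'a::real_normed_vector"
  assumes "smooth c" "\<And>x. R < \<bar>x\<bar> \<Longrightarrow> c x = 0"
  obtains B where "\<And>x. norm (c x) \<le> B" "0 \<le> B"
proof -
  have "compact (c ` {-R..R})"
    by (intro compact_continuous_image smooth_continuous assms) auto
  then obtain B where B: "\<forall>x\<in>{-R..R}. norm (c x) \<le> B" "0 < B"
    by (auto dest!: compact_imp_bounded simp: bounded_pos)
  have "norm (c x) \<le> B" for x
    using B assms(2)[of x] by (cases "R < \<bar>x\<bar>") (auto simp: not_less abs_le_iff)
  with B(2) show thesis by (intro that[of B]) auto
qed

lemma integrable_test_mult:
  fixes c f :: "real \<Rightarrow> complex"
  assumes "locally_integrable f" "smooth c" and supp: "\<And>x. R < \<bar>x\<bar> \<Longrightarrow> c x = 0"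
  shows "integrable lebesgue (\<lambda>x. c x * f x)"
proof -
  obtain B where B: "\<And>x. norm (c x) \<le> B" "0 \<le> B"
    using bounded_if_compact_support[OF assms(2) supp] by blast
  have F: "integrable lebesgue (\<lambda>x. indicator {-R..R} x *\<^sub>R f x)"
    using assms(1) by (simp add: locally_integrable_def set_integrable_def)
  then have "integrable lebesgue (\<lambda>x. B * norm (indicator {-R..R} x *\<^sub>R f x))"
    by (intro integrable_mult_right integrable_norm)
  then have "integrable lebesgue (\<lambda>x. c x * (indicator {-R..R} x *\<^sub>R f x))"
  proof (rule Bochner_Integration.integrable_bound)
    show "(\<lambda>x. c x * (indicator {-R..R} x *\<^sub>R f x)) \<in> borel_measurable lebesgue"
      by (intro borel_measurable_times smooth_measurable assms(2) borel_measurable_integrable F)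
    show "AE x in lebesgue. norm (c x * (indicator {-R..R} x *\<^sub>R f x))
        \<le> norm (B * norm (indicator {-R..R} x *\<^sub>R f x))"
      unfolding real_norm_def using B
      by (intro AE_I2 order_trans[OF _ abs_ge_self]) (simp only: norm_mult mult_right_mono norm_ge_zero)
  qed
  moreover have "c x * (indicator {-R..R} x *\<^sub>R f x) = c x * f x" for x
    using supp[of x] by (auto simp: indicator_def abs_le_iff not_less)
  ultimately show ?thesis by simp
qed

text \<open>The functions in \<open>test_functions\<close> are real valued, but the resolvent
  produces complex ones. The weak identity is applied to real and imaginary parts and recombined by
  linearity.\<close>

lemma weak_deriv_2_complex_test:
  fixes u u' u'' :: "real \<Rightarrow> complex"
  assumes weak: "has_weak_deriv 2 f g"
    and u: "smooth u" "\<And>x. (u has_vector_derivative u' x) (at x)"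
      "\<And>x. (u' has_vector_derivative u'' x) (at x)" "smooth u''"
    and supp: "\<And>x. R < \<bar>x\<bar> \<Longrightarrow> u x = 0"
  shows "(LINT x|lebesgue. u'' x * f x) = (LINT x|lebesgue. u x * g x)"
proof -
  have li: "locally_integrable f" "locally_integrable g"
    using weak by (auto simp: has_weak_deriv_def)
  have supp'': "u'' x = 0" if "R < \<bar>x\<bar>" for x
    using has_vector_derivative_zero_outside[OF u(2) supp]
      has_vector_derivative_zero_outside[OF u(3)] that by blast
  have part: "(LINT x|lebesgue. complex_of_real (L (u'' x)) * f x) = (LINT x|lebesgue. complex_of_real (L (u x)) * g x)"
    if L: "bounded_linear L" for L :: "complex \<Rightarrow> real"
  proof -
    have "deriv (\<lambda>x. L (u x)) = (\<lambda>x. L (u' x))" "deriv (\<lambda>x. L (u' x)) = (\<lambda>x. L (u'' x))"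
      using bounded_linear.has_vector_derivative[OF L u(2)] bounded_linear.has_vector_derivative[OF L u(3)]
      by (auto simp: has_real_derivative_iff_has_vector_derivative[symmetric] intro!: DERIV_imp_deriv)
    then have "(deriv ^^ 2) (\<lambda>x. L (u x)) = (\<lambda>x. L (u'' x))"
      by (simp add: numeral_2_eq_2)
    moreover have "(\<lambda>x. L (u x)) \<in> test_functions"
      by (rule test_functionsI[OF smooth_bounded_linear[OF L u(1)], of R])
         (simp add: supp linear_0[OF bounded_linear.linear[OF L]])
    ultimately show ?thesis
      using weak by (force simp: has_weak_deriv_def scaleR_conv_of_real)
  qed
  have split: "(LINT x|lebesgue. v x * h x) = (LINT x|lebesgue. complex_of_real (Re (v x)) * h x)
      + \<i> * (LINT x|lebesgue. complex_of_real (Im (v x)) * h x)"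
    if "locally_integrable h" "smooth v" "\<And>x. R < \<bar>x\<bar> \<Longrightarrow> v x = 0" for v h
  proof -
    have int: "integrable lebesgue (\<lambda>x. complex_of_real (L (v x)) * h x)"
      if L: "bounded_linear L" for L :: "complex \<Rightarrow> real"
      by (rule integrable_test_mult[OF \<open>locally_integrable h\<close>
            smooth_bounded_linear[OF bounded_linear_of_real smooth_bounded_linear[OF L \<open>smooth v\<close>]], of R])
         (simp add: \<open>\<And>x. R < \<bar>x\<bar> \<Longrightarrow> v x = 0\<close> linear_0[OF bounded_linear.linear[OF L]])
    have "(LINT x|lebesgue. v x * h x) = (LINT x|lebesgue. complex_of_real (Re (v x)) * h x
        + \<i> * (complex_of_real (Im (v x)) * h x))"
      by (intro Bochner_Integration.integral_cong refl)
         (simp add: complex_eq_iff algebra_simps)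
    also have "\<dots> = (LINT x|lebesgue. complex_of_real (Re (v x)) * h x)
      + (LINT x|lebesgue. \<i> * (complex_of_real (Im (v x)) * h x))"
      by (intro Bochner_Integration.integral_add integrable_mult_right int
          bounded_linear_Re bounded_linear_Im)
    finally show ?thesis by simp
  qed
  show ?thesis
    using part[OF bounded_linear_Re] part[OF bounded_linear_Im]
      split[OF li(1) u(4) supp''] split[OF li(2) u(1) supp] by simp
qed

section \<open>Pairing a weak solution with the resolvent of a test function\<close>

lemma integrable_mult_of_square_integrable:
  fixes f g :: "'a \<Rightarrow> complex"
  assumes [measurable]: "f \<in> borel_measurable M" "g \<in> borel_measurable M"
    and "integrable M (\<lambda>x. (norm (f x))\<^sup>2)" "integrable M (\<lambda>x. (norm (g x))\<^sup>2)"
  shows "integrable M (\<lambda>x. f x * g x)"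
proof (rule Bochner_Integration.integrable_bound)
  show "integrable M (\<lambda>x. (norm (f x))\<^sup>2 + (norm (g x))\<^sup>2)" using assms by simp
  have "norm (f x) * norm (g x) \<le> (norm (f x))\<^sup>2 + (norm (g x))\<^sup>2" for x
    using sum_squares_bound[of "norm (f x)" "norm (g x)"] mult_nonneg_nonneg[OF norm_ge_zero norm_ge_zero, of "f x" "g x"]
    by linarith
  then show "AE x in M. norm (f x * g x) \<le> norm ((norm (f x))\<^sup>2 + (norm (g x))\<^sup>2)"
    by (simp add: norm_mult)
qed measurable

text \<open>Writing \<open>\<psi>\<close> as \<open>\<phi>'' - \<mu>^2 \<phi>\<close> and moving
  both derivatives onto \<open>f\<close> turns the integral of \<open>\<psi> f\<close> into that of
  \<open>\<phi> r\<close>, to which the sup bound on \<open>\<phi>\<close> applies. Exponential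
  decay of \<open>\<phi>\<close> and \<open>\<phi>'\<close> against the square integrable
  \<open>f\<close> justifies this in the limit of a cutoff.\<close>

lemma test_bound_of_weak_solution:
  fixes f g r :: "real \<Rightarrow> complex" and \<mu> :: complex and \<psi> :: "real \<Rightarrow> real"
  assumes weak: "has_weak_deriv 2 f g"
    and f_meas: "f \<in> borel_measurable lebesgue" and f2: "integrable lebesgue (\<lambda>x. (norm (f x))\<^sup>2)"
    and r: "integrable lebesgue r" and eqn: "AE x in lebesgue. g x = r x + \<mu>\<^sup>2 * f x"
    and \<mu>: "0 < Re \<mu>" and \<psi>: "smooth \<psi>" and supp: "\<And>x. R < \<bar>x\<bar> \<Longrightarrow> \<psi> x = 0"
  shows "norm (LINT x|lebesgue. \<psi> x *\<^sub>R f x)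
    \<le> (LINT x|lebesgue. norm (r x)) / (2 * norm \<mu>) * (LINT x|lebesgue. \<bar>\<psi> x\<bar>)"
proof -
  define J where "J = (LINT x|lebesgue. \<bar>\<psi> x\<bar>)"
  obtain \<phi> \<phi>' K where \<phi>: "smooth \<phi>" "smooth \<phi>'"
    "\<And>x. (\<phi> has_vector_derivative \<phi>' x) (at x)"
    "\<And>x. (\<phi>' has_vector_derivative (complex_of_real (\<psi> x) + \<mu>\<^sup>2 * \<phi> x)) (at x)"
    "\<And>x. norm (\<phi> x) \<le> J / (2 * norm \<mu>)"
    "\<And>x. norm (\<phi> x) \<le> K * exp (- Re \<mu> * \<bar>x\<bar>)"
    "\<And>x. norm (\<phi>' x) \<le> K * exp (- Re \<mu> * \<bar>x\<bar>)"
    using resolvent_of_test_function[OF \<mu> \<psi> supp] unfolding J_def by blast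
  have li: "locally_integrable f" "locally_integrable g"
    using weak by (auto simp: has_weak_deriv_def)
  have decay_int: "integrable lebesgue (\<lambda>x. p x * f x)"
    if "smooth p" and p: "\<And>x. norm (p x) \<le> K * exp (- Re \<mu> * \<bar>x\<bar>)" for p
  proof (rule integrable_mult_of_square_integrable[OF smooth_measurable[OF that(1)] f_meas _ f2])
    have "integrable lebesgue (\<lambda>x. K\<^sup>2 * exp (- (2 * Re \<mu>) * \<bar>x\<bar>))"
      using \<mu> by (intro integrable_mult_right integrable_exp_minus_abs) auto
    then show "integrable lebesgue (\<lambda>x. (norm (p x))\<^sup>2)"
    proof (rule Bochner_Integration.integrable_bound)
      show "(\<lambda>x. (norm (p x))\<^sup>2) \<in> borel_measurable lebesgue"
        using smooth_measurable[OF that(1)] by measurable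
      have "(norm (p x))\<^sup>2 \<le> (K * exp (- Re \<mu> * \<bar>x\<bar>))\<^sup>2" for x
        by (rule power_mono[OF p]) simp
      then show "AE x in lebesgue. norm ((norm (p x))\<^sup>2) \<le> norm (K\<^sup>2 * exp (- (2 * Re \<mu>) * \<bar>x\<bar>))"
        by (simp add: power_mult_distrib exp_double[symmetric] mult.assoc)
    qed
  qed
  have \<phi>f: "integrable lebesgue (\<lambda>x. \<phi> x * f x)" and \<phi>'f: "integrable lebesgue (\<lambda>x. \<phi>' x * f x)"
    using decay_int \<phi> by blast+
  have \<psi>f: "integrable lebesgue (\<lambda>x. complex_of_real (\<psi> x) * f x)"
    by (rule integrable_test_mult[OF li(1) smooth_bounded_linear[OF bounded_linear_of_real \<psi>], of R])
       (simp add: supp)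
  have J: "0 \<le> J / (2 * norm \<mu>)" by (simp add: J_def)
  have \<phi>r_le: "norm (\<phi> x * r x) \<le> J / (2 * norm \<mu>) * norm (r x)" for x
    using \<phi>(5)[of x] by (simp add: norm_mult mult_right_mono del: times_divide_eq_left)
  have \<phi>r: "integrable lebesgue (\<lambda>x. \<phi> x * r x)"
  proof (rule Bochner_Integration.integrable_bound)
    show "integrable lebesgue (\<lambda>x. J / (2 * norm \<mu>) * norm (r x))" using r by simp
    show "(\<lambda>x. \<phi> x * r x) \<in> borel_measurable lebesgue"
      using smooth_measurable[OF \<phi>(1)] r by measurable
    show "AE x in lebesgue. norm (\<phi> x * r x) \<le> norm (J / (2 * norm \<mu>) * norm (r x))"
      using order_trans[OF \<phi>r_le abs_ge_self] by simp
  qed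

  obtain \<kappa> :: "real \<Rightarrow> real" where \<kappa>: "smooth \<kappa>" "\<kappa> 0 = 1" "\<And>x. 1 < \<bar>x\<bar> \<Longrightarrow> \<kappa> x = 0"
    using smooth_cutoff_exists by blast
  obtain \<kappa>' where \<kappa>': "\<And>x. (\<kappa> has_vector_derivative \<kappa>' x) (at x)" "smooth \<kappa>'"
    using smooth_derivE[OF \<kappa>(1)] by blast
  obtain \<kappa>'' where \<kappa>'': "\<And>x. (\<kappa>' has_vector_derivative \<kappa>'' x) (at x)" "smooth \<kappa>''"
    using smooth_derivE[OF \<kappa>'(2)] by blast
  have \<kappa>'0: "1 < \<bar>x\<bar> \<Longrightarrow> \<kappa>' x = 0" for x
    using has_vector_derivative_zero_outside[OF \<kappa>'(1) \<kappa>(3)] by blast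
  have \<kappa>''0: "1 < \<bar>x\<bar> \<Longrightarrow> \<kappa>'' x = 0" for x
    using has_vector_derivative_zero_outside[OF \<kappa>''(1) \<kappa>'0] by blast
  obtain B0 where B0: "\<And>x. norm (\<kappa> x) \<le> B0" "0 \<le> B0"
    using bounded_if_compact_support[OF \<kappa>(1) \<kappa>(3)] by blast
  obtain B1 where B1: "\<And>x. norm (\<kappa>' x) \<le> B1" "0 \<le> B1"
    using bounded_if_compact_support[OF \<kappa>'(2) \<kappa>'0] by blast
  obtain B2 where B2: "\<And>x. norm (\<kappa>'' x) \<le> B2" "0 \<le> B2"
    using bounded_if_compact_support[OF \<kappa>''(2) \<kappa>''0] by blast

  \<comment> \<open>\<open>\<phi>\<close> has no compact support; it is tested after multiplication by the dilated cutoff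
    \<open>\<kappa> (x / (n + 1))\<close>, whose derivatives vanish in the limit.\<close>
  define c where "c n = 1 / real (Suc n)" for n
  have c: "0 < c n" "c n \<le> 1" for n by (auto simp: c_def field_simps)
  have c_lim: "c \<longlonglongrightarrow> 0" unfolding c_def by (rule LIMSEQ_Suc[OF lim_1_over_n])
  define u where "u n x = \<kappa> (c n * x) *\<^sub>R \<phi> x" for n x
  define u' where "u' n x = \<kappa> (c n * x) *\<^sub>R \<phi>' x + (c n * \<kappa>' (c n * x)) *\<^sub>R \<phi> x" for n x
  define u'' where "u'' n x = \<kappa> (c n * x) *\<^sub>R (complex_of_real (\<psi> x) + \<mu>\<^sup>2 * \<phi> x)
      + (2 * c n * \<kappa>' (c n * x)) *\<^sub>R \<phi>' x + ((c n)\<^sup>2 * \<kappa>'' (c n * x)) *\<^sub>R \<phi> x" for n x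
  have scale: "((\<lambda>x. h (a * x)) has_vector_derivative a * h' (a * x)) (at x)"
    if "\<And>x. (h has_vector_derivative h' x) (at x)" for h h' :: "real \<Rightarrow> real" and a x
  proof -
    have "((*) a has_vector_derivative a) (at x)"
      by (auto intro!: derivative_eq_intros)
    from vector_diff_chain_at[OF this that] show ?thesis by (simp add: o_def)
  qed
  have u_deriv: "(u n has_vector_derivative u' n x) (at x)" for n x
    unfolding u_def u'_def
    by (intro bounded_bilinear.has_vector_derivative[OF bounded_bilinear_scaleR] scale \<kappa>' \<phi>)
  have u'_deriv: "(u' n has_vector_derivative u'' n x) (at x)" for n x
  proof -
    have "(u' n has_vector_derivative
        (\<kappa> (c n * x) *\<^sub>R (complex_of_real (\<psi> x) + \<mu>\<^sup>2 * \<phi> x) + (c n * \<kappa>' (c n * x)) *\<^sub>R \<phi>' x)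
        + ((c n * \<kappa>' (c n * x)) *\<^sub>R \<phi>' x + (c n * (c n * \<kappa>'' (c n * x))) *\<^sub>R \<phi> x)) (at x)"
      unfolding u'_def
      by (intro has_vector_derivative_add bounded_bilinear.has_vector_derivative[OF bounded_bilinear_scaleR]
          has_vector_derivative_mult_right scale \<kappa>' \<kappa>'' \<phi>)
    then show ?thesis
      by (simp add: u''_def power2_eq_square scaleR_conv_of_real algebra_simps)
  qed
  have affine: "smooth (\<lambda>x. h (c n * x))" if "smooth h" for h :: "real \<Rightarrow> real" and n
    using smooth_affine[OF that, of "c n" 0] by simp
  have u_smooth: "smooth (u n)" for n
    unfolding u_def by (intro smooth_scaleR affine \<kappa> \<phi>)
  have u''_smooth: "smooth (u'' n)" for n
    by (metis u_smooth smooth_derivE u_deriv u'_deriv ext vector_derivative_unique_at)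
  have u_supp: "u n x = 0" if "real (Suc n) < \<bar>x\<bar>" for n x
  proof -
    have "1 < \<bar>c n * x\<bar>" using that by (simp add: c_def abs_mult field_simps)
    then show ?thesis using \<kappa>(3) by (simp add: u_def)
  qed
  have u''_supp: "u'' n x = 0" if "real (Suc n) < \<bar>x\<bar>" for n x
    using has_vector_derivative_zero_outside[OF u_deriv u_supp]
      has_vector_derivative_zero_outside[OF u'_deriv] that by blast

  \<comment> \<open>This is \<open>u'' n * f - u n * g\<close> after inserting the equation for
    \<open>g\<close>: the terms with \<open>\<mu>^2\<close> cancel, and each remaining one is a
    bounded factor times an integrable function.\<close>
  define D where "D n x = \<kappa> (c n * x) *\<^sub>R (complex_of_real (\<psi> x) * f x)
      + (2 * c n * \<kappa>' (c n * x)) *\<^sub>R (\<phi>' x * f x) + ((c n)\<^sup>2 * \<kappa>'' (c n * x)) *\<^sub>R (\<phi> x * f x)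
      - \<kappa> (c n * x) *\<^sub>R (\<phi> x * r x)" for n x
  have scaleR_meas: "(\<lambda>x. a x *\<^sub>R b x) \<in> borel_measurable lebesgue"
    if "smooth a" "integrable lebesgue b" for a :: "real \<Rightarrow> real" and b :: "real \<Rightarrow> complex"
    using that by (intro borel_measurable_scaleR smooth_measurable borel_measurable_integrable)
  have D_meas: "D n \<in> borel_measurable lebesgue" for n
    unfolding D_def
    by (intro borel_measurable_diff borel_measurable_add scaleR_meas smooth_mult smooth_const affine
        \<kappa>(1) \<kappa>'(2) \<kappa>''(2) \<psi>f \<phi>f \<phi>'f \<phi>r)
  have D_int: "(LINT x|lebesgue. D n x) = 0" for n
  proof -
    have int1: "integrable lebesgue (\<lambda>x. u'' n x * f x)"
      using u''_supp by (rule integrable_test_mult[OF li(1) u''_smooth])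
    have int2: "integrable lebesgue (\<lambda>x. u n x * g x)"
      using u_supp by (rule integrable_test_mult[OF li(2) u_smooth])
    have "(LINT x|lebesgue. D n x) = (LINT x|lebesgue. u'' n x * f x - u n x * g x)"
    proof (rule integral_cong_AE[OF D_meas])
      show "(\<lambda>x. u'' n x * f x - u n x * g x) \<in> borel_measurable lebesgue"
        using int1 int2 by (intro borel_measurable_integrable) simp
      show "AE x in lebesgue. D n x = u'' n x * f x - u n x * g x"
        using eqn by eventually_elim (simp add: D_def u''_def u_def algebra_simps scaleR_conv_of_real)
    qed
    also have "\<dots> = (LINT x|lebesgue. u'' n x * f x) - (LINT x|lebesgue. u n x * g x)"
      by (rule Bochner_Integration.integral_diff[OF int1 int2])
    also have "\<dots> = 0"
      using weak_deriv_2_complex_test[OF weak u_smooth u_deriv u'_deriv u''_smooth u_supp] by simp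
    finally show ?thesis .
  qed
  \<comment> \<open>Since \<open>c n\<close> is at most 1, the bounds on the cutoff and its
    derivatives hold uniformly in \<open>n\<close>, which makes this a dominating function.\<close>
  define w where "w x = B0 * norm (complex_of_real (\<psi> x) * f x) + (2 * B1) * norm (\<phi>' x * f x)
      + B2 * norm (\<phi> x * f x) + B0 * norm (\<phi> x * r x)" for x
  have "(\<lambda>n. LINT x|lebesgue. D n x) \<longlonglongrightarrow> (LINT x|lebesgue. complex_of_real (\<psi> x) * f x - \<phi> x * r x)"
  proof (rule integral_dominated_convergence)
    show "integrable lebesgue w" unfolding w_def using \<psi>f \<phi>f \<phi>'f \<phi>r
      by (intro Bochner_Integration.integrable_add integrable_mult_right integrable_norm)
    show "D n \<in> borel_measurable lebesgue" for n by (rule D_meas)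
    show "(\<lambda>x. complex_of_real (\<psi> x) * f x - \<phi> x * r x) \<in> borel_measurable lebesgue"
      using \<psi>f \<phi>r by (intro borel_measurable_integrable) simp
    have lim: "(\<lambda>n. h (c n * x)) \<longlonglongrightarrow> h 0" if "smooth h" for h :: "real \<Rightarrow> real" and x
    proof -
      have "isCont h 0" using smooth_continuous[OF that, of UNIV] by (simp add: continuous_on_eq_continuous_at)
      moreover have "(\<lambda>n. c n * x) \<longlonglongrightarrow> 0" using tendsto_mult_right[OF c_lim, of x] by simp
      ultimately show ?thesis by (rule isCont_tendsto_compose)
    qed
    show "AE x in lebesgue. (\<lambda>n. D n x) \<longlonglongrightarrow> complex_of_real (\<psi> x) * f x - \<phi> x * r x"
    proof (rule AE_I2)
      fix x
      have "(\<lambda>n. D n x) \<longlonglongrightarrow> \<kappa> 0 *\<^sub>R (complex_of_real (\<psi> x) * f x)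
        + (2 * 0 * \<kappa>' 0) *\<^sub>R (\<phi>' x * f x) + (0\<^sup>2 * \<kappa>'' 0) *\<^sub>R (\<phi> x * f x) - \<kappa> 0 *\<^sub>R (\<phi> x * r x)"
        unfolding D_def by (intro tendsto_intros lim c_lim \<kappa>(1) \<kappa>'(2) \<kappa>''(2))
      then show "(\<lambda>n. D n x) \<longlonglongrightarrow> complex_of_real (\<psi> x) * f x - \<phi> x * r x"
        by (simp add: \<kappa>(2))
    qed
    show "AE x in lebesgue. norm (D n x) \<le> w x" for n
    proof (rule AE_I2)
      fix x
      have k1: "\<bar>c n * \<kappa>' (c n * x)\<bar> \<le> B1"
        using B1(1)[of "c n * x"] c[of n] mult_left_le_one_le[of "\<bar>\<kappa>' (c n * x)\<bar>" "c n"]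
        by (simp add: abs_mult)
      have k2: "\<bar>(c n)\<^sup>2 * \<kappa>'' (c n * x)\<bar> \<le> B2"
        using B2(1)[of "c n * x"] c[of n] mult_left_le_one_le[of "\<bar>\<kappa>'' (c n * x)\<bar>" "(c n)\<^sup>2"]
        by (simp add: abs_mult power_le_one)
      have "norm (D n x) \<le> norm (\<kappa> (c n * x) *\<^sub>R (complex_of_real (\<psi> x) * f x))
        + norm ((2 * c n * \<kappa>' (c n * x)) *\<^sub>R (\<phi>' x * f x))
        + norm (((c n)\<^sup>2 * \<kappa>'' (c n * x)) *\<^sub>R (\<phi> x * f x))
        + norm (\<kappa> (c n * x) *\<^sub>R (\<phi> x * r x))"
        unfolding D_def
        by (rule order_trans[OF norm_triangle_ineq4] add_right_mono order_trans[OF norm_triangle_ineq] order_refl)+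
      also have "\<dots> \<le> w x"
        unfolding w_def norm_scaleR
        using B0(1)[of "c n * x"] k1 k2
        by (intro add_mono mult_right_mono) (auto simp: abs_mult)
      finally show "norm (D n x) \<le> w x" .
    qed
  qed
  then have "(LINT x|lebesgue. complex_of_real (\<psi> x) * f x - \<phi> x * r x) = 0"
    unfolding D_int by (rule LIMSEQ_unique[OF _ tendsto_const])
  then have "(LINT x|lebesgue. \<psi> x *\<^sub>R f x) = (LINT x|lebesgue. \<phi> x * r x)"
    by (simp add: Bochner_Integration.integral_diff[OF \<psi>f \<phi>r] scaleR_conv_of_real)
  also have "norm \<dots> \<le> (LINT x|lebesgue. norm (\<phi> x * r x))" by (rule integral_norm_bound)
  also have "\<dots> \<le> (LINT x|lebesgue. J / (2 * norm \<mu>) * norm (r x))"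
    by (rule integral_mono) (use \<phi>r r \<phi>r_le in simp_all)
  finally show ?thesis by (simp add: J_def mult.commute)
qed

section \<open>The eigenvalue bound\<close>

theorem theorem4:
  fixes V :: "real \<Rightarrow> complex" and z :: complex
  assumes "V \<in> Lp 1 \<inter> Lp 2"
    and "is_eigenvalue (sobolev 2 2) (schroedinger V) z"
    and "z \<notin> complex_of_real ` {0<..}"
  shows "cmod z \<le> (L1_norm V)\<^sup>2 / 4"
proof (cases "z = 0")
  case False
  define \<mu> where "\<mu> = csqrt (- z)"
  have \<mu>2: "\<mu>\<^sup>2 = - z" by (simp add: \<mu>_def)
  have \<mu>: "0 < Re \<mu>"
  proof (rule ccontr)
    assume "\<not> 0 < Re \<mu>"
    moreover have "0 \<le> Re \<mu>" unfolding \<mu>_def using csqrt_principal[of "- z"] by auto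
    ultimately have "Re \<mu> = 0" by simp
    \<comment> \<open>The principal root has nonnegative real part; were it purely imaginary,
      \<open>z\<close> would be the square of a real number and, being nonzero, positive.\<close>
    then have "z = complex_of_real ((Im \<mu>)\<^sup>2)"
      using \<mu>2 by (auto simp: complex_eq_iff power2_eq_square)
    moreover from this False have "0 < (Im \<mu>)\<^sup>2" by auto
    ultimately show False using assms(3) by blast
  qed
  have V_meas: "V \<in> borel_measurable lebesgue" and V1: "integrable lebesgue (\<lambda>x. norm (V x))"
    and V2: "integrable lebesgue (\<lambda>x. (norm (V x))\<^sup>2)"
    using assms(1) by (auto simp: Lp_def)
  obtain f where f: "f \<in> sobolev 2 2" "\<not> (AE x in lebesgue. f x = 0)"
    "AE x in lebesgue. schroedinger V f x = z * f x"
    using assms(2) by (auto simp: is_eigenvalue_def)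
  have f_meas: "f \<in> borel_measurable lebesgue" and f2: "integrable lebesgue (\<lambda>x. (norm (f x))\<^sup>2)"
    using f(1) by (auto simp: sobolev_def Lp_def)
  \<comment> \<open>\<open>weak_deriv\<close> is a choice, so existence must be supplied before its
    defining property can be used.\<close>
  have "\<exists>g. has_weak_deriv 2 f g" using f(1) by (auto simp: sobolev_def)
  then have weak: "has_weak_deriv 2 f (weak_deriv 2 f)"
    unfolding weak_deriv_def by (rule someI_ex)
  define r where "r x = V x * f x" for x
  have r: "integrable lebesgue r"
    unfolding r_def by (rule integrable_mult_of_square_integrable[OF V_meas f_meas V2 f2])
  have eqn: "AE x in lebesgue. weak_deriv 2 f x = r x + \<mu>\<^sup>2 * f x"
    using f(3) by eventually_elim (simp add: schroedinger_def r_def \<mu>2 algebra_simps)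
  define N where "N = (LINT x|lebesgue. norm (r x))"
  have N: "0 \<le> N / (2 * norm \<mu>)" by (simp add: N_def)
  have bound: "AE x in lebesgue. norm (f x) \<le> N / (2 * norm \<mu>)"
    using weak unfolding N_def
    by (intro ess_bound_if_test_bound test_bound_of_weak_solution[OF weak f_meas f2 r eqn \<mu>])
       (auto simp: has_weak_deriv_def)
  \<comment> \<open>\<open>N\<close> appears on both sides of the final estimate and is cancelled
    there; this is where the eigenfunction has to be nonzero.\<close>
  have "N \<noteq> 0"
  proof
    assume "N = 0"
    with bound have "AE x in lebesgue. f x = 0" by simp
    with f(2) show False by contradiction
  qed
  moreover have "N \<le> (LINT x|lebesgue. norm (V x) * (N / (2 * norm \<mu>)))"
    unfolding N_def
  proof (rule integral_mono_AE)
    show "AE x in lebesgue. norm (r x) \<le> norm (V x) * ((LINT x|lebesgue. norm (r x)) / (2 * norm \<mu>))"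
      using bound by eventually_elim (simp add: r_def norm_mult mult_left_mono N_def del: times_divide_eq_right)
  qed (use r V1 in auto)
  then have "N \<le> L1_norm V * (N / (2 * norm \<mu>))"
    using V1 by (simp add: L1_norm_def)
  moreover have "0 \<le> N" by (simp add: N_def)
  moreover have "0 < norm \<mu>" using \<mu> by auto
  ultimately have "2 * norm \<mu> \<le> L1_norm V" by (simp add: field_simps)
  then have "(2 * norm \<mu>)\<^sup>2 \<le> (L1_norm V)\<^sup>2" by (intro power_mono) auto
  moreover have "(norm \<mu>)\<^sup>2 = norm z" by (simp add: norm_power[symmetric] \<mu>2)
  ultimately show ?thesis by (simp add: power_mult_distrib)
qed simp

end
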